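(* Let $\Omega$ be a set in $\mathbb{R}^{n+1}$ that contains $(0,\ldots,0,1)$, and let $L = \operatorname{lin}(\operatorname{cl}\operatorname{cone}(\Omega))$. Then $\mathscr{I}(\Omega)$ is polyhedral if and only if $\operatorname{cl}\operatorname{cone}(\operatorname{proj}_{L^\perp}\Omega)$ has finitely many different extreme rays.
   Context: For $\Omega \subseteq \mathbb{R}^{n+1}$, elements of $\Omega$ are written $(\alpha,\beta)$ with $\alpha \in \mathbb{R}^n$, $\beta \in \mathbb{R}$, and the (cutting-plane) closure given by $\Omega$ is $\mathscr{I}(\Omega) := \bigcap_{(\alpha,\beta)\in\Omega}\{x\in\mathbb{R}^n \mid \alpha^{\mathsf T}x \le \beta\}$. $\operatorname{cone}(S)$ is the conical hull of $S$, i.e. the set of all conical (nonnegative linear) combinations of finitely many points of $S$; $\operatorname{cl}(S)$ is the topological closure of $S$, and $\operatorname{cl}\operatorname{cone}(S) = \operatorname{cl}(\operatorname{cone}(S))$. $\operatorname{lin}(S) := S\cap(-S)$ is the linearity space of $S$ (for a convex cone it is the largest linear subspace contained in it). $L^\perp$ is the orthogonal complement of the linear subspace $L$, and $\operatorname{proj}_{L^\perp}\Omega$ is the image of $\Omega$ under orthogonal projection onto $L^\perp$. A set is polyhedral if it is a polyhedron, i.e. an intersection of finitely many closed half-spaces. An extreme ray of a convex cone $K$ is (represented by) a nonzero $r \in K$ such that $r=u+v$ with $u,v\in K$ implies that $u$ and $v$ are nonnegative multiples of $r$; two rays $r^1,r^2$ are different iff there is no $\lambda>0$ with $r^1=\lambda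 r^2$.
   Formalization: The closure given by Ω is additionally assumed nonempty; without this the "only if" direction fails, e.g. for Ω = C × ℝ with C the second-order cone in ℝ³, whose closure is empty (hence polyhedral) while the projected cone has infinitely many extreme rays. *)

theory Defs
  imports "HOL-Analysis.Analysis"
begin

(* R^(n+1) is rendered as the product (real ^ 'n) \<times> real, whose inner product and topology are
   the Euclidean ones, so that its elements are literally pairs (\<alpha>, \<beta>). *)

definition cut_closure :: "((real ^ 'n) \<times> real) set \<Rightarrow> (real ^ 'n) set" where
  "cut_closure \<Omega> = (\<Inter>(\<alpha>, \<beta>)\<in>\<Omega>. {x. \<alpha> \<bullet> x \<le> \<beta>})"

(* The conical hull is the library's "convex_cone hull"; "cone hull" would not be closed under
   addition. The following lemma confirms that it consists of the finite conical combinations. *)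

lemma convex_cone_hull_conical_combinations:
  fixes S :: "'a::real_vector set"
  shows "convex_cone hull S = {\<Sum>v\<in>T. c v *\<^sub>R v | T c. finite T \<and> T \<subseteq> S \<and> (\<forall>v\<in>T. 0 \<le> c v)}"
    (is "_ = ?C")
proof (rule hull_unique)
  show "S \<subseteq> ?C"
  proof
    fix x assume "x \<in> S"
    then show "x \<in> ?C"
      unfolding mem_Collect_eq by (intro exI[of _ "{x}"] exI[of _ "\<lambda>_. 1::real"]) simp
  qed
  show "convex_cone ?C"
    unfolding convex_cone_iff
  proof (intro conjI ballI allI impI)
    show "0 \<in> ?C"
      unfolding mem_Collect_eq by (intro exI[of _ "{}"] exI[of _ "\<lambda>_. 0"]) simp
  next
    fix x y assume "x \<in> ?C" "y \<in> ?C"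
    then obtain T c U d where
      T: "x = (\<Sum>v\<in>T. c v *\<^sub>R v)" "finite T" "T \<subseteq> S" "\<forall>v\<in>T. 0 \<le> c v" and
      U: "y = (\<Sum>v\<in>U. d v *\<^sub>R v)" "finite U" "U \<subseteq> S" "\<forall>v\<in>U. 0 \<le> d v"
      by blast
    define e where "e v = (if v \<in> T then c v else 0) + (if v \<in> U then d v else 0)" for v
    have "x = (\<Sum>v\<in>T \<union> U. (if v \<in> T then c v else 0) *\<^sub>R v)"
      unfolding T(1) using T(2) U(2) by (intro sum.mono_neutral_cong_left) auto
    moreover have "y = (\<Sum>v\<in>T \<union> U. (if v \<in> U then d v else 0) *\<^sub>R v)"
      unfolding U(1) using T(2) U(2) by (intro sum.mono_neutral_cong_left) auto
    ultimately have "x + y = (\<Sum>v\<in>T \<union> U. e v *\<^sub>R v)"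
      by (simp add: e_def scaleR_add_left sum.distrib)
    moreover have "finite (T \<union> U)" "T \<union> U \<subseteq> S" "\<forall>v\<in>T \<union> U. 0 \<le> e v"
      using T U by (auto simp: e_def)
    ultimately show "x + y \<in> ?C" by blast
  next
    fix x and a :: real assume "x \<in> ?C" "0 \<le> a"
    then obtain T c where
      T: "x = (\<Sum>v\<in>T. c v *\<^sub>R v)" "finite T" "T \<subseteq> S" "\<forall>v\<in>T. 0 \<le> c v"
      by blast
    have "a *\<^sub>R x = (\<Sum>v\<in>T. (a * c v) *\<^sub>R v)" "\<forall>v\<in>T. 0 \<le> a * c v"
      using T \<open>0 \<le> a\<close> by (simp_all add: scaleR_sum_right)
    then show "a *\<^sub>R x \<in> ?C"
      using T(2,3) unfolding mem_Collect_eq by (intro exI[of _ T] exI[of _ "\<lambda>v. a * c v"]) simp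
  qed
next
  fix K assume K: "S \<subseteq> K" "convex_cone K"
  show "?C \<subseteq> K"
  proof
    fix x assume "x \<in> ?C"
    then obtain T c where
      T: "x = (\<Sum>v\<in>T. c v *\<^sub>R v)" "finite T" "T \<subseteq> S" "\<forall>v\<in>T. 0 \<le> c v"
      by blast
    from T(2-4) have "(\<Sum>v\<in>T. c v *\<^sub>R v) \<in> K"
    proof (induction T rule: finite_induct)
      case empty
      show ?case using K(2) by (simp add: convex_cone_contains_0)
    next
      case (insert v F)
      then have "c v *\<^sub>R v \<in> K" "(\<Sum>v\<in>F. c v *\<^sub>R v) \<in> K"
        using K by (auto intro: convex_cone_scaleR)
      then show ?case
        using insert.hyps K(2) by (simp add: convex_cone_add)
    qed
    then show "x \<in> K" using T(1) by simp
  qed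
qed

definition lin_space :: "'a::real_vector set \<Rightarrow> 'a set" where
  "lin_space S = S \<inter> uminus ` S"

(* Orthogonal projection onto W, meaningful when W is a linear subspace. *)
definition orth_proj :: "'a::euclidean_space set \<Rightarrow> 'a \<Rightarrow> 'a" where
  "orth_proj W x = (THE y. y \<in> W \<and> x - y \<in> W\<^sup>\<bottom>)"

lemma orth_proj_eq_iff:
  fixes W :: "'a::euclidean_space set"
  assumes W: "subspace W"
  shows "orth_proj W x = y \<longleftrightarrow> y \<in> W \<and> x - y \<in> W\<^sup>\<bottom>"
proof -
  have ex1: "\<exists>!y. y \<in> W \<and> x - y \<in> W\<^sup>\<bottom>"
  proof (rule ex_ex1I)
    obtain y z where y: "y \<in> span W" and z: "\<And>w. w \<in> span W \<Longrightarrow> orthogonal z w"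
      and x: "x = y + z"
      using orthogonal_subspace_decomp_exists[of W x] by blast
    have "y \<in> W"
      using y unfolding span_eq_iff[THEN iffD2, OF W] .
    moreover have "orthogonal w z" if "w \<in> W" for w
      using z[OF span_base[OF that]] by (rule orthogonal_commute[THEN iffD1])
    then have "z \<in> W\<^sup>\<bottom>"
      unfolding orthogonal_comp_def by blast
    then have "x - y \<in> W\<^sup>\<bottom>"
      unfolding x by simp
    ultimately show "\<exists>y. y \<in> W \<and> x - y \<in> W\<^sup>\<bottom>"
      by blast
  next
    fix y z assume y: "y \<in> W \<and> x - y \<in> W\<^sup>\<bottom>" and z: "z \<in> W \<and> x - z \<in> W\<^sup>\<bottom>"
    have d: "y - z \<in> W"
      using subspace_diff[OF W] y z by blast
    have "(x - z) - (x - y) \<in> W\<^sup>\<bottom>"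
      using subspace_diff[OF subspace_orthogonal_comp] y z by blast
    then have "y - z \<in> W\<^sup>\<bottom>"
      by simp
    with d have "orthogonal (y - z) (y - z)"
      unfolding orthogonal_comp_def by blast
    then show "y = z"
      by (simp add: orthogonal_self)
  qed
  show ?thesis
    unfolding orth_proj_def using theI'[OF ex1] ex1 by blast
qed

definition extreme_ray :: "'a::real_vector set \<Rightarrow> 'a \<Rightarrow> bool" where
  "extreme_ray K r \<longleftrightarrow> r \<in> K \<and> r \<noteq> 0 \<and>
     (\<forall>u\<in>K. \<forall>v\<in>K. r = u + v \<longrightarrow> (\<exists>a\<ge>0. u = a *\<^sub>R r) \<and> (\<exists>b\<ge>0. v = b *\<^sub>R r))"

definition same_ray :: "('a::real_vector \<times> 'a) set" where
  "same_ray = {(r, s). \<exists>c>0. r = c *\<^sub>R s}"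

(* The set of different extreme rays: representatives modulo positive scaling. *)
definition extreme_rays :: "'a::real_vector set \<Rightarrow> 'a set set" where
  "extreme_rays K = {r. extreme_ray K r} // same_ray"

end

theory Submission
  imports Defs
begin

text \<open>
  Let \<open>K\<close> be the closed conical hull of \<open>\<Omega>\<close>. By Farkas' lemma, \<open>K\<close> consists of exactly the
  inequalities that are valid for the cut closure, so the cut closure is a polyhedron iff \<open>K\<close> is
  finitely generated. Splitting off the linearity space gives \<open>K = L + (K \<inter> L\<^sup>\<bottom>)\<close>, where
  \<open>K \<inter> L\<^sup>\<bottom>\<close> is both the projection of \<open>K\<close> and the closed conical hull of the projection of
  \<open>\<Omega>\<close>. This cone is pointed, so it has a compact base whose extreme points span its extreme rays,
  and by Krein-Milman it is finitely generated iff it has finitely many extreme rays.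
\<close>

section \<open>Closed convex cones and separation through the origin\<close>

lemma convex_cone_closure_hull:
  fixes S :: "'a::euclidean_space set"
  shows "convex_cone (closure (convex_cone hull S))"
  using convex_cone_hull_nonempty[of S] convex_closure[OF convex_convex_cone_hull[of S]]
    conic_closure[OF conic_convex_cone_hull[of S]]
  by (subst convex_cone_def) simp

text \<open>A strictly separating hyperplane can be moved to the origin: the threshold
  \<open>b\<close> is negative because the cone contains 0, and a functional bounded below on a cone
  is nonnegative there.\<close>

lemma closed_convex_cone_separation:
  fixes K :: "'a::euclidean_space set"
  assumes K: "convex_cone K" "closed K" and z: "z \<notin> K"
  obtains a where "a \<bullet> z > 0" "\<And>x. x \<in> K \<Longrightarrow> a \<bullet> x \<le> 0"
proof -
  have "convex K" using K(1) by (simp add: convex_cone_def)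
  then obtain a b where ab: "a \<bullet> z < b" "\<And>x. x \<in> K \<Longrightarrow> b < a \<bullet> x"
    using separating_hyperplane_closed_point[OF _ K(2) z] by blast
  have "b < 0" using ab(2)[OF convex_cone_contains_0[OF K(1)]] by simp
  have "0 \<le> a \<bullet> x" if x: "x \<in> K" for x
  proof (rule ccontr)
    assume "\<not> 0 \<le> a \<bullet> x"
    then have neg: "a \<bullet> x < 0" by simp
    \<comment> \<open>Rescaling \<open>x\<close> by this factor gives a point of the cone with value
      exactly \<open>b\<close>, against the strict bound.\<close>
    then have "0 \<le> b / (a \<bullet> x)" using \<open>b < 0\<close> by (simp add: divide_nonpos_neg)
    then have "(b / (a \<bullet> x)) *\<^sub>R x \<in> K" using K(1) x by (simp add: convex_cone_scaleR)
    from ab(2)[OF this] neg show False by simp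
  qed
  with ab \<open>b < 0\<close> show ?thesis by (intro that[of "- a"]) auto
qed

section \<open>Farkas' lemma for the cut closure\<close>

text \<open>Homogenisation: pairing with \<open>(x, -1)\<close> turns validity at a fixed
  \<open>x\<close> into a linear condition on the inequality \<open>p\<close>.\<close>

lemma mem_cut_closure_iff: "x \<in> cut_closure \<Omega> \<longleftrightarrow> (\<forall>p\<in>\<Omega>. p \<bullet> (x, -1) \<le> 0)"
  by (force simp: cut_closure_def)

lemma cut_closure_antimono: "A \<subseteq> B \<Longrightarrow> cut_closure B \<subseteq> cut_closure A"
  by (auto simp: cut_closure_def)

text \<open>The inequalities valid at a fixed point form a closed halfspace through the origin, so
  conical combinations and limits remain valid.\<close>

lemma cut_closure_closed_cone:
  "cut_closure (closure (convex_cone hull \<Omega>)) = cut_closure \<Omega>"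
proof
  have "\<Omega> \<subseteq> closure (convex_cone hull \<Omega>)"
    by (meson closure_subset hull_subset order_trans)
  then show "cut_closure (closure (convex_cone hull \<Omega>)) \<subseteq> cut_closure \<Omega>"
    by (rule cut_closure_antimono)
  show "cut_closure \<Omega> \<subseteq> cut_closure (closure (convex_cone hull \<Omega>))"
  proof
    fix x assume x: "x \<in> cut_closure \<Omega>"
    let ?H = "{p. (x, -1) \<bullet> p \<le> 0}"
    have "\<Omega> \<subseteq> ?H" using x by (auto simp: mem_cut_closure_iff inner_commute)
    then have "convex_cone hull \<Omega> \<subseteq> ?H"
      by (rule hull_minimal) (rule convex_cone_halfspace_le)
    then have "closure (convex_cone hull \<Omega>) \<subseteq> ?H"
      by (rule closure_minimal) (rule closed_halfspace_le)
    then show "x \<in> cut_closure (closure (convex_cone hull \<Omega>))"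
      by (auto simp: mem_cut_closure_iff inner_commute)
  qed
qed

text \<open>A vector separating \<open>p\<close> from the cone has last coordinate at most 0. If it
  is negative, rescaling gives a point of the cut closure that violates \<open>p\<close>; if it is
  0, a recession direction does, and nonemptiness supplies the base point from which to follow
  it.\<close>

lemma closed_cone_eq_valid_inequalities:
  fixes \<Omega> :: "((real ^ 'n) \<times> real) set"
  assumes one: "(0, 1) \<in> \<Omega>" and ne: "cut_closure \<Omega> \<noteq> {}"
  shows "closure (convex_cone hull \<Omega>) = {p. \<forall>x\<in>cut_closure \<Omega>. p \<bullet> (x, -1) \<le> 0}"
    (is "?K = ?V")
proof
  show "?K \<subseteq> ?V"
    using cut_closure_closed_cone[of \<Omega>] mem_cut_closure_iff[of _ ?K] by blast
  show "?V \<subseteq> ?K"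
  proof (rule subsetI, rule ccontr)
    fix p assume p: "p \<in> ?V" and "p \<notin> ?K"
    obtain w where w: "w \<bullet> p > 0" "\<And>q. q \<in> ?K \<Longrightarrow> w \<bullet> q \<le> 0"
      using closed_convex_cone_separation[OF convex_cone_closure_hull closed_closure \<open>p \<notin> ?K\<close>]
      by blast
    obtain y t where "w = (y, t)" by fastforce
    with w have pos: "(y, t) \<bullet> p > 0" and le: "\<And>q. q \<in> ?K \<Longrightarrow> (y, t) \<bullet> q \<le> 0"
      by auto
    have in_K: "q \<in> ?K" if "q \<in> \<Omega>" for q
      using that by (meson closure_subset hull_subset subset_eq)
    have "t \<le> 0" using le[OF in_K[OF one]] by simp
    show False
    proof (cases "t = 0")
      case False
      with \<open>t \<le> 0\<close> have t: "t < 0" by simp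
      \<comment> \<open>The positive factor \<open>- 1 / t\<close> normalises the last coordinate of
        \<open>(y, t)\<close> to -1, making it the homogenisation of a point.\<close>
      have scale: "q \<bullet> ((- 1 / t) *\<^sub>R y, -1) = (- 1 / t) * ((y, t) \<bullet> q)" for q :: "(real ^ 'n) \<times> real"
        using t by (cases q) (simp add: inner_commute field_simps)
      have "(- 1 / t) *\<^sub>R y \<in> cut_closure \<Omega>"
        unfolding mem_cut_closure_iff scale using le[OF in_K] t
        by (auto intro!: mult_nonneg_nonpos simp: divide_nonpos_neg)
      with p have "p \<bullet> ((- 1 / t) *\<^sub>R y, -1) \<le> 0" by blast
      with pos t show False unfolding scale by (simp add: field_simps)
    next
      \<comment> \<open>Here \<open>y\<close> is a recession direction of the cut closure along which \<open>p\<close> is unbounded.\<close>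
      case True
      obtain x where x: "x \<in> cut_closure \<Omega>" using ne by blast
      have shift: "q \<bullet> (x + s *\<^sub>R y, -1) = q \<bullet> (x, -1) + s * ((y, t) \<bullet> q)"
        for s and q :: "(real ^ 'n) \<times> real"
        using True by (cases q) (simp add: inner_commute inner_right_distrib)
      \<comment> \<open>This step length makes the pairing of \<open>p\<close> with the shifted
        point equal to 1.\<close>
      define s where "s = (1 - p \<bullet> (x, -1)) / ((y, t) \<bullet> p)"
      have "s \<ge> 0" using p x pos by (force simp: s_def intro!: divide_nonneg_pos)
      then have "x + s *\<^sub>R y \<in> cut_closure \<Omega>"
        unfolding mem_cut_closure_iff shift
        using x le[OF in_K] by (auto simp: mem_cut_closure_iff intro!: add_nonpos_nonpos mult_nonneg_nonpos)
      with p have "p \<bullet> (x + s *\<^sub>R y, -1) \<le> 0" by blast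
      then show False unfolding shift using pos by (simp add: s_def)
    qed
  qed
qed

lemma polyhedron_cut_closure_finite:
  assumes "finite F"
  shows "polyhedron (cut_closure F)"
proof -
  have "cut_closure F = \<Inter>((\<lambda>(a, b). {x. a \<bullet> x \<le> b}) ` F)"
    by (simp add: cut_closure_def)
  also have "polyhedron \<dots>"
    using assms by (intro polyhedron_Inter) (auto simp: polyhedron_halfspace_le)
  finally show ?thesis .
qed

text \<open>Two systems that contain \<open>(0, 1)\<close> and have the same nonempty cut closure
  have the same closed cone, and a finitely generated cone is already closed.\<close>

lemma polyhedron_cut_closure_iff:
  fixes \<Omega> :: "((real ^ 'n) \<times> real) set"
  assumes one: "(0, 1) \<in> \<Omega>" and ne: "cut_closure \<Omega> \<noteq> {}"
  shows "polyhedron (cut_closure \<Omega>) \<longleftrightarrow>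
    (\<exists>F. finite F \<and> closure (convex_cone hull \<Omega>) = convex_cone hull F)"
proof
  assume "polyhedron (cut_closure \<Omega>)"
  then obtain H where H: "finite H" "cut_closure \<Omega> = \<Inter>H"
    "\<forall>h\<in>H. \<exists>a b. a \<noteq> 0 \<and> h = {x. a \<bullet> x \<le> b}"
    unfolding polyhedron_def by blast
  then obtain a b where ab: "\<And>h. h \<in> H \<Longrightarrow> h = {x. a h \<bullet> x \<le> b h}" by metis
  \<comment> \<open>The added pair encodes \<open>0 \<le> 1\<close>, which cuts nothing off but
    makes Farkas' lemma applicable to \<open>F\<close>.\<close>
  define F where "F = insert (0, 1) ((\<lambda>h. (a h, b h)) ` H)"
  have F: "finite F" "(0, 1) \<in> F" using H(1) by (auto simp: F_def)
  have "cut_closure F = \<Inter>H"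
    using ab by (auto simp: F_def cut_closure_def)
  with H have eq: "cut_closure F = cut_closure \<Omega>" by simp
  have "closure (convex_cone hull \<Omega>) = closure (convex_cone hull F)"
    using closed_cone_eq_valid_inequalities[OF one ne]
      closed_cone_eq_valid_inequalities[OF F(2)] ne eq by simp
  also have "\<dots> = convex_cone hull F"
    using closed_convex_cone_hull[OF F(1)] by simp
  finally show "\<exists>F. finite F \<and> closure (convex_cone hull \<Omega>) = convex_cone hull F"
    using F(1) by blast
next
  assume "\<exists>F. finite F \<and> closure (convex_cone hull \<Omega>) = convex_cone hull F"
  then obtain F where F: "finite F" "closure (convex_cone hull \<Omega>) = convex_cone hull F" by blast
  have "closure (convex_cone hull F) = convex_cone hull F"
    using closed_convex_cone_hull[OF F(1)] by simp
  then have "cut_closure F = cut_closure \<Omega>"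
    by (metis F(2) cut_closure_closed_cone)
  then show "polyhedron (cut_closure \<Omega>)"
    using polyhedron_cut_closure_finite[OF F(1)] by simp
qed

section \<open>Extreme rays and finite generation\<close>

text \<open>Every extreme ray is represented by a generator: in a conical combination equal to
  \<open>r\<close>, extremality forces each nonzero term to be a positive multiple of
  \<open>r\<close>.\<close>

lemma finite_extreme_rays_convex_cone_hull:
  assumes "finite F"
  shows "finite (extreme_rays (convex_cone hull F))"
proof -
  let ?K = "convex_cone hull F"
  have "extreme_rays ?K \<subseteq> (\<lambda>v. same_ray `` {v}) ` F"
  proof
    fix R assume "R \<in> extreme_rays ?K"
    then obtain r where r: "extreme_ray ?K r" and R: "R = same_ray `` {r}"
      by (auto simp: extreme_rays_def quotient_def)
    from r have "r \<in> ?K" "r \<noteq> 0" by (auto simp: extreme_ray_def)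
    then obtain T c where T: "r = (\<Sum>v\<in>T. c v *\<^sub>R v)" "finite T" "T \<subseteq> F" "\<forall>v\<in>T. 0 \<le> c v"
      unfolding convex_cone_hull_conical_combinations by blast
    obtain v where v: "v \<in> T" "c v *\<^sub>R v \<noteq> 0"
      using \<open>r \<noteq> 0\<close> unfolding T(1) by (meson sum.neutral)
    have split: "r = c v *\<^sub>R v + (\<Sum>w\<in>T - {v}. c w *\<^sub>R w)"
      unfolding T(1) using T(2) v(1) by (rule sum.remove)
    have "c v *\<^sub>R v \<in> ?K"
      using T v by (intro convex_cone_hull_mul hull_inc) auto
    moreover have "(\<Sum>w\<in>T - {v}. c w *\<^sub>R w) \<in> ?K"
      unfolding convex_cone_hull_conical_combinations mem_Collect_eq
      using T by (intro exI[of _ "T - {v}"] exI[of _ c]) auto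
    moreover have "\<exists>a\<ge>0. u = a *\<^sub>R r" if "u \<in> ?K" "w \<in> ?K" "r = u + w" for u w
      using r that unfolding extreme_ray_def by blast
    ultimately obtain a where a: "a \<ge> 0" "c v *\<^sub>R v = a *\<^sub>R r"
      using split by blast
    have pos: "a > 0" "c v > 0" using a v T(4) by (auto simp: less_le)
    define d where "d = c v / a"
    have d: "d > 0" "r = d *\<^sub>R v"
    proof -
      show "d > 0" using pos by (simp add: d_def)
      have "r = (1 / a) *\<^sub>R (a *\<^sub>R r)" using pos by simp
      also have "\<dots> = d *\<^sub>R v" unfolding a(2)[symmetric] by (simp add: d_def)
      finally show "r = d *\<^sub>R v" .
    qed
    \<comment> \<open>Classes are images under \<open>same_ray\<close> in the whole space, so they
      agree once \<open>r\<close> and \<open>v\<close> are related to the same vectors.\<close>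
    have "(r, s) \<in> same_ray \<longleftrightarrow> (v, s) \<in> same_ray" for s
    proof
      assume "(r, s) \<in> same_ray"
      then obtain e where e: "e > 0" "r = e *\<^sub>R s" by (auto simp: same_ray_def)
      have "v = (1 / d) *\<^sub>R r" using d by simp
      then have "v = (e / d) *\<^sub>R s" unfolding e(2) by simp
      then show "(v, s) \<in> same_ray" using d e by (auto simp: same_ray_def intro!: exI[of _ "e / d"])
    next
      assume "(v, s) \<in> same_ray"
      then obtain e where e: "e > 0" "v = e *\<^sub>R s" by (auto simp: same_ray_def)
      then show "(r, s) \<in> same_ray" using d by (auto simp: same_ray_def intro!: exI[of _ "d * e"])
    qed
    then have "R = same_ray `` {v}" unfolding R by auto
    then show "R \<in> (\<lambda>v. same_ray `` {v}) ` F" using v T by blast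
  qed
  then show ?thesis using assms finite_surj by blast
qed

text \<open>The bound by a multiple of the norm is what makes the slice \<open>a \<bullet> x = 1\<close> of the cone bounded.\<close>

lemma pointed_cone_positive_functional:
  fixes K :: "'a::euclidean_space set"
  assumes K: "convex_cone K" "closed K" and pointed: "lin_space K \<subseteq> {0}"
  obtains a b where "b > 0" "\<And>x. x \<in> K \<Longrightarrow> a \<bullet> x \<ge> b * norm x"
proof -
  define C where "C = convex hull (K \<inter> sphere 0 1)"
  have "compact C"
    unfolding C_def using K(2) by (intro compact_convex_hull closed_Int_compact) auto
  \<comment> \<open>If unit vectors of the cone had 0 as a convex combination, moving one nonzero
    term to the other side would put both it and its negative in \<open>K\<close>, against
    pointedness.\<close>
  moreover have "0 \<notin> C"
  proof
    assume "0 \<in> C"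
    then obtain T c where T: "finite T" "T \<subseteq> K \<inter> sphere 0 1" "\<forall>v\<in>T. 0 \<le> c v" "sum c T = 1"
      "(\<Sum>v\<in>T. c v *\<^sub>R v) = 0"
      unfolding C_def convex_hull_explicit by blast
    obtain v where v: "v \<in> T" "c v \<noteq> 0" using T(4) by (metis sum.neutral zero_neq_one)
    have "(\<Sum>w\<in>T - {v}. c w *\<^sub>R w) \<in> convex_cone hull K"
      unfolding convex_cone_hull_conical_combinations mem_Collect_eq
      using T by (intro exI[of _ "T - {v}"] exI[of _ c]) auto
    then have "(\<Sum>w\<in>T - {v}. c w *\<^sub>R w) \<in> K" using K(1) by (simp add: hull_same)
    moreover have "(\<Sum>w\<in>T - {v}. c w *\<^sub>R w) = - (c v *\<^sub>R v)"
      using T(5) sum.remove[OF T(1) v(1), of "\<lambda>w. c w *\<^sub>R w"] by (simp add: add_eq_0_iff)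
    ultimately have "- (c v *\<^sub>R v) \<in> K" by simp
    moreover have "c v *\<^sub>R v \<in> K" using K(1) T v by (auto intro!: convex_cone_scaleR)
    ultimately have "c v *\<^sub>R v \<in> lin_space K"
      unfolding lin_space_def by (metis IntI image_eqI minus_minus)
    with pointed v(2) have "v = 0" by auto
    with T(2) v(1) show False by auto
  qed
  ultimately obtain a b where ab: "b > 0" "\<And>x. x \<in> C \<Longrightarrow> a \<bullet> x > b"
    using separating_hyperplane_closed_0[of C] compact_imp_closed
    by (metis C_def convex_convex_hull)
  have "a \<bullet> x \<ge> b * norm x" if "x \<in> K" for x
  proof (cases "x = 0")
    case False
    \<comment> \<open>Normalising to the sphere turns the constant bound on \<open>C\<close> into
      one proportional to the norm.\<close>
    have "(1 / norm x) *\<^sub>R x \<in> K \<inter> sphere 0 1"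
      using that False K(1) by (auto intro!: convex_cone_scaleR)
    from ab(2)[unfolded C_def, OF hull_inc[OF this]]
    have "b < a \<bullet> ((1 / norm x) *\<^sub>R x)" .
    then show ?thesis using False by (simp add: field_simps)
  qed simp
  with ab(1) show ?thesis using that by blast
qed

text \<open>Extreme points of the slice at height 1 give distinct extreme rays, since the height
  fixes the scale. Hence they are finitely many, and they generate the slice and, by rescaling, the
  cone.\<close>

lemma pointed_cone_finitely_generated:
  fixes K :: "'a::euclidean_space set"
  assumes K: "convex_cone K" "closed K" and pointed: "lin_space K \<subseteq> {0}"
    and fin: "finite (extreme_rays K)"
  obtains F where "finite F" "K = convex_cone hull F"
proof -
  obtain a b where b: "b > 0" and a: "\<And>x. x \<in> K \<Longrightarrow> a \<bullet> x \<ge> b * norm x"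
    using pointed_cone_positive_functional[OF K pointed] by blast
  have a_nonneg: "a \<bullet> x \<ge> 0" if "x \<in> K" for x
    using a[OF that] b by (meson less_imp_le mult_nonneg_nonneg norm_ge_zero order_trans)
  have a_zero: "x = 0" if "x \<in> K" "a \<bullet> x = 0" for x
    using a[OF that(1)] that(2) b by (auto simp: mult_le_0_iff)
  define B where "B = K \<inter> {x. a \<bullet> x = 1}"
  have "bounded B"
    unfolding bounded_iff
  proof (intro exI ballI)
    fix x assume "x \<in> B"
    then show "norm x \<le> 1 / b" using a[of x] b by (auto simp: B_def field_simps)
  qed
  moreover have "closed B"
    unfolding B_def using K(2) closed_hyperplane by (rule closed_Int)
  moreover have "convex B"
    unfolding B_def using K(1) by (intro convex_Int convex_hyperplane) (simp add: convex_cone_def)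
  ultimately have KM: "B = convex hull {x. x extreme_point_of B}"
    by (intro Krein_Milman_Minkowski) (simp_all add: compact_eq_bounded_closed)
  define F where "F = {x. x extreme_point_of B}"
  have FB: "F \<subseteq> B" by (auto simp: F_def extreme_point_of_def)
  have ray: "extreme_ray K r" if r: "r \<in> F" for r
    unfolding extreme_ray_def
  proof (intro conjI ballI impI)
    show "r \<in> K" "r \<noteq> 0" using r FB by (auto simp: B_def)
    have r1: "a \<bullet> r = 1" using r FB by (auto simp: B_def)
    have left: "\<exists>c\<ge>0. u = c *\<^sub>R r" if uv: "u \<in> K" "v \<in> K" "r = u + v" for u v
    proof -
      \<comment> \<open>The heights of \<open>u\<close> and \<open>v\<close> add up to 1. A summand
        of height 0 vanishes; otherwise both rescale into the slice, and \<open>r\<close> is their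
        convex combination with weights \<open>s\<close> and \<open>1 - s\<close>.\<close>
      define s where "s = a \<bullet> u"
      have av: "a \<bullet> v = 1 - s" using r1 uv(3) by (simp add: s_def inner_right_distrib)
      have s: "0 \<le> s" "s \<le> 1" using a_nonneg[OF uv(1)] a_nonneg[OF uv(2)] av by (auto simp: s_def)
      consider "s = 0" | "s = 1" | "0 < s" "s < 1" using s by linarith
      then show ?thesis
      proof cases
        case 1
        then have "u = 0" using a_zero[OF uv(1)] by (simp add: s_def)
        then show ?thesis by (intro exI[of _ 0]) simp
      next
        case 2
        then have "v = 0" using a_zero[OF uv(2)] av by simp
        then show ?thesis using uv(3) by (intro exI[of _ 1]) simp
      next
        case 3
        let ?u = "(1 / s) *\<^sub>R u" and ?v = "(1 / (1 - s)) *\<^sub>R v"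
        have "?u \<in> B" "?v \<in> B"
          using 3 uv av K(1) by (auto simp: B_def s_def[symmetric] intro!: convex_cone_scaleR)
        then have notin: "r \<notin> open_segment ?u ?v"
          using r by (auto simp: F_def extreme_point_of_def)
        \<comment> \<open>The first weight is left unsimplified to match the segment parameter
          \<open>1 - s\<close>.\<close>
        have comb: "r = (1 - (1 - s)) *\<^sub>R ?u + (1 - s) *\<^sub>R ?v" using 3 uv(3) by simp
        have "?u = ?v"
        proof (rule ccontr)
          assume "?u \<noteq> ?v"
          then have "r \<in> open_segment ?u ?v"
            unfolding in_segment using 3 comb by (intro conjI exI[of _ "1 - s"]) auto
          with notin show False ..
        qed
        then have "r = ?u" using comb by (metis scaleR_collapse)
        then have "u = s *\<^sub>R r" using 3 by simp
        then show ?thesis using 3(1) less_imp_le by blast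
      qed
    qed
    fix u v assume uv: "u \<in> K" "v \<in> K" "r = u + v"
    show "\<exists>c\<ge>0. u = c *\<^sub>R r" using left uv by blast
    show "\<exists>c\<ge>0. v = c *\<^sub>R r" using left[OF uv(2,1)] uv(3) by (simp add: add.commute)
  qed
  have "finite F"
  proof (rule inj_on_finite[OF _ _ fin])
    show "inj_on (\<lambda>r. same_ray `` {r}) F"
    proof (rule inj_onI)
      fix r s assume rs: "r \<in> F" "s \<in> F" "same_ray `` {r} = same_ray `` {s}"
      have "(s, s) \<in> same_ray" by (auto simp: same_ray_def intro!: exI[of _ 1])
      then have "(r, s) \<in> same_ray" using rs(3) by blast
      then obtain c where c: "r = c *\<^sub>R s" by (auto simp: same_ray_def)
      \<comment> \<open>Equal heights force the scaling factor \<open>c\<close> to be 1.\<close>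
      have "a \<bullet> r = 1" "a \<bullet> s = 1" using rs FB by (auto simp: B_def)
      then show "r = s" using c by simp
    qed
    show "(\<lambda>r. same_ray `` {r}) ` F \<subseteq> extreme_rays K"
      using ray by (auto simp: extreme_rays_def quotient_def)
  qed
  moreover have "K = convex_cone hull F"
  proof
    show "convex_cone hull F \<subseteq> K"
      using FB K(1) by (intro hull_minimal) (auto simp: B_def)
    show "K \<subseteq> convex_cone hull F"
    proof
      fix x assume x: "x \<in> K"
      show "x \<in> convex_cone hull F"
      proof (cases "x = 0")
        case True
        then show ?thesis by (simp add: convex_cone_hull_contains_0)
      next
        case False
        then have pos: "a \<bullet> x > 0" using a_zero[OF x] a_nonneg[OF x] by force
        then have "(1 / (a \<bullet> x)) *\<^sub>R x \<in> B"
          using x K(1) by (auto simp: B_def intro!: convex_cone_scaleR)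
        then have "(1 / (a \<bullet> x)) *\<^sub>R x \<in> convex_cone hull F"
          using KM convex_hull_subset_convex_cone_hull[of F] unfolding F_def by blast
        then have "(a \<bullet> x) *\<^sub>R (1 / (a \<bullet> x)) *\<^sub>R x \<in> convex_cone hull F"
          using pos by (intro convex_cone_hull_mul[of _ F "a \<bullet> x"]) auto
        moreover have "(a \<bullet> x) *\<^sub>R (1 / (a \<bullet> x)) *\<^sub>R x = x" using pos by simp
        ultimately show ?thesis by metis
      qed
    qed
  qed
  ultimately show ?thesis using that by blast
qed

section \<open>Splitting off the linearity space\<close>

lemma subspace_lin_space:
  assumes K: "convex_cone K"
  shows "subspace (lin_space K)"
proof -
  have iff: "x \<in> lin_space K \<longleftrightarrow> x \<in> K \<and> - x \<in> K" for x
    unfolding lin_space_def by (metis IntE IntI image_iff minus_minus)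
  have scale: "c *\<^sub>R x \<in> K" if "x \<in> K" "- x \<in> K" for c x
  proof (cases "c \<ge> 0")
    case False
    then have "(- c) *\<^sub>R (- x) \<in> K" using K that by (intro convex_cone_scaleR) auto
    then show ?thesis by simp
  qed (use K that in \<open>simp add: convex_cone_scaleR\<close>)
  show ?thesis
    unfolding subspace_def iff
  proof (intro conjI ballI allI)
    fix c x assume "x \<in> lin_space K"
    then have "x \<in> K" "- x \<in> K" by (auto simp: iff)
    then show "c *\<^sub>R x \<in> K" "- (c *\<^sub>R x) \<in> K" using scale[of x c] scale[of x "- c"] by auto
  next
    fix x y assume "x \<in> lin_space K" "y \<in> lin_space K"
    then have "x \<in> K" "- x \<in> K" "y \<in> K" "- y \<in> K" by (auto simp: iff)
    then show "x + y \<in> K" "- (x + y) \<in> K"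
      using convex_cone_add[OF K, of x y] convex_cone_add[OF K, of "- x" "- y"] by auto
  qed (use K convex_cone_contains_0 in auto)
qed

text \<open>A basis together with its negatives suffices: the cone of a symmetric set is symmetric,
  hence a subspace.\<close>

lemma subspace_finitely_generated_cone:
  fixes L :: "'a::euclidean_space set"
  assumes L: "subspace L"
  obtains G where "finite G" "L = convex_cone hull G"
proof -
  obtain B where B: "finite B" "span B = L"
    using basis_subspace_exists[OF L] by metis
  define G where "G = B \<union> uminus ` B"
  have "convex_cone hull G \<subseteq> L"
  proof (rule hull_minimal)
    show "G \<subseteq> L" using B(2) by (auto simp: G_def span_base span_neg)
  qed (rule subspace_imp_convex_cone[OF L])
  moreover have "subspace (convex_cone hull G)"
  proof -
    have "uminus ` (convex_cone hull G) = convex_cone hull (uminus ` G)"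
      by (rule convex_cone_hull_linear_image[symmetric])
        (simp add: linear_iff)
    also have "uminus ` G = G" by (force simp: G_def image_Un image_image)
    finally show ?thesis
      using convex_cone_convex_cone_hull[of G] subspace_convex_cone_symmetric by blast
  qed
  then have "span B \<subseteq> convex_cone hull G"
    by (intro span_minimal) (auto simp: G_def hull_inc)
  ultimately show ?thesis using that[of G] B by (auto simp: G_def)
qed

lemma linear_orth_proj:
  fixes W :: "'a::euclidean_space set"
  assumes W: "subspace W"
  shows "linear (orth_proj W)"
proof (rule linearI)
  have mem: "orth_proj W x \<in> W" "x - orth_proj W x \<in> W\<^sup>\<bottom>" for x
    using orth_proj_eq_iff[OF W] by blast+
  fix x y c
  show "orth_proj W (x + y) = orth_proj W x + orth_proj W y"
    unfolding orth_proj_eq_iff[OF W]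
    using subspace_add[OF W mem(1)[of x] mem(1)[of y]]
      subspace_add[OF subspace_orthogonal_comp mem(2)[of x] mem(2)[of y]]
    by (simp add: algebra_simps)
  show "orth_proj W (c *\<^sub>R x) = c *\<^sub>R orth_proj W x"
    unfolding orth_proj_eq_iff[OF W]
    using subspace_scale[OF W mem(1)[of x], of c]
      subspace_scale[OF subspace_orthogonal_comp mem(2)[of x], of c]
    by (simp add: algebra_simps)
qed

text \<open>The residual \<open>x - P x\<close> lies in the linearity space, so projecting does not
  leave \<open>K\<close> and the image is a slice of \<open>K\<close>. This makes the image closed,
  which fails for general linear images of closed cones.\<close>

lemma orth_proj_closed_cone:
  fixes S :: "'a::euclidean_space set"
  defines "K \<equiv> closure (convex_cone hull S)"
  defines "P \<equiv> orth_proj ((lin_space K)\<^sup>\<bottom>)"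
  shows "closure (convex_cone hull (P ` S)) = P ` K"
    and "P ` K = K \<inter> (lin_space K)\<^sup>\<bottom>"
    and "\<And>x. x - P x \<in> lin_space K"
proof -
  let ?L = "lin_space K"
  have K: "convex_cone K" unfolding K_def by (rule convex_cone_closure_hull)
  have L: "subspace ?L" using K by (rule subspace_lin_space)
  have W: "subspace (?L\<^sup>\<bottom>)" by (rule subspace_orthogonal_comp)
  \<comment> \<open>The residual is orthogonal to the complement of \<open>?L\<close>, and the
    double complement of a subspace is the subspace itself.\<close>
  have P: "P x \<in> ?L\<^sup>\<bottom>" "x - P x \<in> ?L" for x
    using orth_proj_eq_iff[OF W, of x "P x"] orthogonal_comp_self[OF L] by (auto simp: P_def)
  then show "\<And>x. x - P x \<in> lin_space K" by blast
  have lin: "linear P" unfolding P_def by (rule linear_orth_proj[OF W])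
  have "P x \<in> K" if "x \<in> K" for x
  proof -
    have "- (x - P x) \<in> ?L" using L P(2) by (rule subspace_neg)
    then have "- (x - P x) \<in> K" by (simp add: lin_space_def)
    from convex_cone_add[OF K that this] show ?thesis by simp
  qed
  moreover have "P x = x" if "x \<in> ?L\<^sup>\<bottom>" for x
    unfolding P_def orth_proj_eq_iff[OF W]
    using that subspace_0[OF subspace_orthogonal_comp] by simp
  ultimately show PK: "P ` K = K \<inter> ?L\<^sup>\<bottom>"
    using P(1) by (force simp: image_iff)
  have hull: "convex_cone hull (P ` S) = P ` (convex_cone hull S)"
    using lin by (rule convex_cone_hull_linear_image)
  show "closure (convex_cone hull (P ` S)) = P ` K"
  proof
    have "closed (P ` K)"
      unfolding PK unfolding K_def using closed_subspace[OF subspace_orthogonal_comp] by (intro closed_Int) auto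
    moreover have "P ` (convex_cone hull S) \<subseteq> P ` K"
      unfolding K_def by (intro image_mono closure_subset)
    ultimately show "closure (convex_cone hull (P ` S)) \<subseteq> P ` K"
      unfolding hull by (rule closure_minimal[rotated])
    show "P ` K \<subseteq> closure (convex_cone hull (P ` S))"
      unfolding hull K_def by (rule closure_linear_image_subset[OF lin])
  qed
qed

text \<open>Generators of \<open>K\<close> project to generators of \<open>Q\<close>; conversely,
  \<open>x = P x + (x - P x)\<close> shows that generators of \<open>Q\<close> and of the linearity
  space together generate \<open>K\<close>.\<close>

lemma finitely_generated_iff_finite_extreme_rays:
  fixes S :: "'a::euclidean_space set"
  defines "K \<equiv> closure (convex_cone hull S)"
  shows "(\<exists>F. finite F \<and> K = convex_cone hull F) \<longleftrightarrow>
    finite (extreme_rays (closure (convex_cone hull (orth_proj ((lin_space K)\<^sup>\<bottom>) ` S))))"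
proof -
  let ?L = "lin_space K"
  define P where "P = orth_proj (?L\<^sup>\<bottom>)"
  note cone = orth_proj_closed_cone[where S = S, folded K_def, folded P_def]
  define Q where "Q = closure (convex_cone hull (P ` S))"
  have K: "convex_cone K" unfolding K_def by (rule convex_cone_closure_hull)
  have L: "subspace ?L" using K by (rule subspace_lin_space)
  have QK: "Q = P ` K" "Q = K \<inter> ?L\<^sup>\<bottom>" using cone by (auto simp: Q_def)
  have lin: "linear P" unfolding P_def by (rule linear_orth_proj[OF subspace_orthogonal_comp])
  have "(\<exists>F. finite F \<and> K = convex_cone hull F) \<longleftrightarrow> finite (extreme_rays Q)"
  proof
    assume "\<exists>F. finite F \<and> K = convex_cone hull F"
    then obtain F where F: "finite F" "K = convex_cone hull F" by blast
    have "Q = convex_cone hull (P ` F)"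
      unfolding QK(1) F(2) using lin by (rule convex_cone_hull_linear_image[symmetric])
    then show "finite (extreme_rays Q)"
      using F(1) by (simp add: finite_extreme_rays_convex_cone_hull)
  next
    assume fin: "finite (extreme_rays Q)"
    have "convex_cone Q" "closed Q" unfolding Q_def by (auto simp: convex_cone_closure_hull)
    \<comment> \<open>A vector of \<open>lin_space Q\<close> lies both in \<open>?L\<close> and in
      its orthogonal complement.\<close>
    moreover have "lin_space Q \<subseteq> {0}"
    proof
      fix x assume "x \<in> lin_space Q"
      then have "x \<in> ?L" "x \<in> ?L\<^sup>\<bottom>" by (auto simp: lin_space_def QK(2))
      then have "orthogonal x x" by (auto simp: orthogonal_comp_def)
      then show "x \<in> {0}" by (simp add: orthogonal_self)
    qed
    ultimately obtain F where F: "finite F" "Q = convex_cone hull F"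
      using pointed_cone_finitely_generated fin by blast
    obtain G where G: "finite G" "?L = convex_cone hull G"
      using subspace_finitely_generated_cone[OF L] by blast
    have "K = convex_cone hull (F \<union> G)"
    proof
      have "F \<subseteq> K" "G \<subseteq> K"
        using F(2) G(2) QK(2) by (auto simp: lin_space_def hull_inc)
      then show "convex_cone hull (F \<union> G) \<subseteq> K" using K by (intro hull_minimal) auto
      show "K \<subseteq> convex_cone hull (F \<union> G)"
      proof
        fix x assume "x \<in> K"
        then have "P x \<in> convex_cone hull F" "x - P x \<in> convex_cone hull G"
          using cone(3) by (auto simp: F(2)[symmetric] G(2)[symmetric] QK(1))
        then have "P x \<in> convex_cone hull (F \<union> G)" "x - P x \<in> convex_cone hull (F \<union> G)"
          by (meson Un_upper1 Un_upper2 hull_mono subsetD)+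
        then have "P x + (x - P x) \<in> convex_cone hull (F \<union> G)" by (rule convex_cone_hull_add)
        then show "x \<in> convex_cone hull (F \<union> G)" by simp
      qed
    qed
    then show "\<exists>F. finite F \<and> K = convex_cone hull F" using F(1) G(1) by blast
  qed
  then show ?thesis unfolding Q_def P_def .
qed

theorem theorem1:
  fixes \<Omega> :: "((real ^ 'n) \<times> real) set" and L :: "((real ^ 'n) \<times> real) set"
  assumes "(0, 1) \<in> \<Omega>"
    and "cut_closure \<Omega> \<noteq> {}"
    and "L = lin_space (closure (convex_cone hull \<Omega>))"
  shows "polyhedron (cut_closure \<Omega>) \<longleftrightarrow>
    finite (extreme_rays (closure (convex_cone hull (orth_proj (L\<^sup>\<bottom>) ` \<Omega>))))"
  unfolding polyhedron_cut_closure_iff[OF assms(1,2)] assms(3)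
  by (rule finitely_generated_iff_finite_extreme_rays)

end
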